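(* Let $\gamma\in(0,2)$ and let $C_1,C_2,C_3>0$ be constants. Let $c(z)dz$ be a positive Radon measure on $\mathbf{R}^N\setminus\{0\}$ such that $$\int_{\mathbf{R}^N}\min(|z|^2,1)\,c(z)dz\le C_1,\qquad \frac{C_2}{|z|^{N+\gamma}}\le |c(z)|\le \frac{C_3}{|z|^{N+\gamma}}\quad\text{for all } 0<|z|\le 1 ,$$ and such that $\int_{D}1\,c(z)dz>0$ for any nonempty open set $D\subset\mathbf{R}^N$. Let $F:\mathbf{R}^N\times\mathbf{R}^N\times\mathbf{S}^N\to\mathbf{R}$ be continuous, degenerate elliptic ($F(x,p,X)\ge F(x,p,Y)$ whenever $X\le Y$, for all $x,p\in\mathbf{R}^N$, $X,Y\in\mathbf{S}^N$), and such that $F(x,0,O)\ge0$ for all $x\in\mathbf{R}^N$. Let $u$ be a viscosity subsolution of $$F(x,\nabla u,\nabla^2u)-\int_{\mathbf{R}^N}\big[u(x+z)-u(x)-\langle\nabla u(x),z\rangle\big]c(z)dz=0,\qquad x\in\mathbf{R}^N,$$ and assume that it takes a maximum at a point $x_0\in\mathbf{R}^N$, i.e. $u(x)\le u(x_0)$ for all $x\in\mathbf{R}^N$. Then $u$ is constant almost everywhere in $\mathbf{R}^N$.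
   Context: $\mathbf{S}^N$ is the set of real symmetric $N\times N$ matrices with its usual order; $I$ is the identity matrix and $O$ the zero matrix. For $u$ upper semicontinuous on $\mathbf{R}^N$, $J^{2,+}_{\mathbf{R}^N}u(\hat x)$ is the second-order superjet: the set of $(p,X)\in\mathbf{R}^N\times\mathbf{S}^N$ with $u(\hat x+z)\le u(\hat x)+\langle p,z\rangle+\frac12\langle Xz,z\rangle+o(|z|^2)$ as $z\to0$. Hence for every $\delta>0$ there is $\varepsilon>0$ such that (A) $u(\hat x+z)\le u(\hat x)+\langle p,z\rangle+\frac12\langle Xz,z\rangle+\delta|z|^2$ for $|z|\le\varepsilon$. Definition of viscosity subsolution. An upper semicontinuous $u$ is a viscosity subsolution of the equation $$F(x,\nabla u,\nabla^2u)-\int_{\mathbf{R}^N}\big[u(x+z)-u(x)-\langle\nabla u(x),z\rangle\big]c(z)dz=0,\qquad x\in\mathbf{R}^N,$$ if for any $\hat x\in\mathbf{R}^N$, any $(p,X)\in J^{2,+}_{\mathbf{R}^N}u(\hat x)$, any pair of positive numbers $(\varepsilon,\delta)$ satisfying (A), and any $0<\varepsilon'\le\varepsilon$, $$F(\hat x,p,X)-\int_{|z|<\varepsilon'}\tfrac12\langle(X+2\delta I)z,z\rangle c(z)dz-\int_{|z|\ge\varepsilon'}[u(\hat x+z)-u(\hat x)-\langle z,p\rangle]c(z)dz\le0.$$ *)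

theory Defs
  imports "HOL-Analysis.Analysis" "HOL-Library.Landau_Symbols"
begin

definition symmetric_matrices :: "(real ^ 'n ^ 'n) set" where
  "symmetric_matrices = {X. transpose X = X}"

text \<open>The usual order of symmetric matrices, that is, the order of the quadratic forms. The
  library's \<open>\<le>\<close> on type \<open>real ^ 'n ^ 'n\<close> compares entries and is not this order.\<close>

definition matrix_le :: "real ^ 'n ^ 'n \<Rightarrow> real ^ 'n ^ 'n \<Rightarrow> bool" where
  "matrix_le X Y \<longleftrightarrow> (\<forall>z. (X *v z) \<bullet> z \<le> (Y *v z) \<bullet> z)"

definition degenerate_elliptic ::
    "(real ^ 'n \<Rightarrow> real ^ 'n \<Rightarrow> real ^ 'n ^ 'n \<Rightarrow> real) \<Rightarrow> bool" where
  "degenerate_elliptic F \<longleftrightarrow>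
     (\<forall>x p. \<forall>X\<in>symmetric_matrices. \<forall>Y\<in>symmetric_matrices.
        matrix_le X Y \<longrightarrow> F x p X \<ge> F x p Y)"

definition upper_semicontinuous :: "('a::topological_space \<Rightarrow> real) \<Rightarrow> bool" where
  "upper_semicontinuous u \<longleftrightarrow> (\<forall>x. \<forall>e>0. \<forall>\<^sub>F y in nhds x. u y < u x + e)"

text \<open>The measure \<open>c(z)dz\<close>. It lives on the space without the origin, so the value of \<open>c\<close> at
  \<open>0\<close> is irrelevant.\<close>

definition levy_measure :: "(real ^ 'n \<Rightarrow> real) \<Rightarrow> (real ^ 'n) measure" where
  "levy_measure c = density (lebesgue_on (- {0})) (\<lambda>z. ennreal (c z))"

text \<open>\<open>c(z)dz\<close> is a positive Radon measure on the space without the origin. Since \<open>ennreal\<close>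
  truncates negative values, positivity of the density is required separately. On this locally
  compact and second countable space, finiteness on compact sets already implies regularity.\<close>

definition positive_radon_density :: "(real ^ 'n \<Rightarrow> real) \<Rightarrow> bool" where
  "positive_radon_density c \<longleftrightarrow>
     c \<in> borel_measurable (lebesgue_on (- {0})) \<and>
     (AE z in lebesgue_on (- {0}). 0 \<le> c z) \<and>
     (\<forall>K. compact K \<and> K \<subseteq> - {0} \<longrightarrow> emeasure (levy_measure c) K < \<infinity>)"

text \<open>Integral of a real function with values in \<open>[-\<infinity>, \<infinity>]\<close>, meaningful when the positive or the
  negative part has finite integral. The library's Bochner integral is not suitable for the
  integral over large jumps: it is \<open>0\<close> by convention on non-integrable functions, while a
  function that is bounded above but not below can have integral \<open>-\<infinity>\<close>.\<close>

definition ext_integral_exists :: "'a measure \<Rightarrow> 'a set \<Rightarrow> ('a \<Rightarrow> real) \<Rightarrow> bool" where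
  "ext_integral_exists M A f \<longleftrightarrow>
     set_borel_measurable M A f \<and>
     ((\<integral>\<^sup>+z\<in>A. ennreal (f z) \<partial>M) < \<infinity> \<or> (\<integral>\<^sup>+z\<in>A. ennreal (- f z) \<partial>M) < \<infinity>)"

definition ext_integral :: "'a measure \<Rightarrow> 'a set \<Rightarrow> ('a \<Rightarrow> real) \<Rightarrow> ereal" where
  "ext_integral M A f =
     enn2ereal (\<integral>\<^sup>+z\<in>A. ennreal (f z) \<partial>M) - enn2ereal (\<integral>\<^sup>+z\<in>A. ennreal (- f z) \<partial>M)"

definition superjet :: "(real ^ 'n \<Rightarrow> real) \<Rightarrow> real ^ 'n \<Rightarrow> ((real ^ 'n) \<times> (real ^ 'n ^ 'n)) set" where
  "superjet u x = {(p, X). X \<in> symmetric_matrices \<and>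
     (\<exists>r \<in> o[at 0](\<lambda>z. (norm z)\<^sup>2). \<forall>\<^sub>F z in at 0.
        u (x + z) \<le> u x + p \<bullet> z + 1/2 * ((X *v z) \<bullet> z) + r z)}"

definition superjet_bound ::
    "(real ^ 'n \<Rightarrow> real) \<Rightarrow> real ^ 'n \<Rightarrow> real ^ 'n \<Rightarrow> real ^ 'n ^ 'n \<Rightarrow> real \<Rightarrow> real \<Rightarrow> bool" where
  "superjet_bound u x p X \<epsilon> \<delta> \<longleftrightarrow>
     (\<forall>z. norm z \<le> \<epsilon> \<longrightarrow>
        u (x + z) \<le> u x + p \<bullet> z + 1/2 * ((X *v z) \<bullet> z) + \<delta> * (norm z)\<^sup>2)"

text \<open>Viscosity subsolutions of
  \<open>F(x, \<nabla>u, \<nabla>\<^sup>2u) - \<integral> [u(x+z) - u(x) - \<langle>\<nabla>u(x), z\<rangle>] c(z)dz = 0\<close> on the whole space.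
  The inequality is imposed whenever the integral over \<open>|z| \<ge> \<epsilon>'\<close> has a value in \<open>[-\<infinity>, \<infinity>]\<close>;
  in particular it fails if that value is \<open>-\<infinity>\<close>. The term \<open>\<langle>z, p\<rangle>\<close> need not be integrable at
  infinity, so for \<open>p \<noteq> 0\<close> the integral can have the form \<open>\<infinity> - \<infinity>\<close>, and then the inequality has
  no meaning.\<close>

definition viscosity_subsolution ::
    "(real ^ 'n \<Rightarrow> real ^ 'n \<Rightarrow> real ^ 'n ^ 'n \<Rightarrow> real) \<Rightarrow> (real ^ 'n \<Rightarrow> real) \<Rightarrow>
     (real ^ 'n \<Rightarrow> real) \<Rightarrow> bool" where
  "viscosity_subsolution F c u \<longleftrightarrow>
     upper_semicontinuous u \<and>
     (\<forall>x p X \<epsilon> \<delta> \<epsilon>'.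
        (p, X) \<in> superjet u x \<and> 0 < \<epsilon> \<and> 0 < \<delta> \<and> superjet_bound u x p X \<epsilon> \<delta> \<and>
        0 < \<epsilon>' \<and> \<epsilon>' \<le> \<epsilon> \<and>
        ext_integral_exists (levy_measure c) {z. norm z \<ge> \<epsilon>'}
          (\<lambda>z. u (x + z) - u x - z \<bullet> p) \<longrightarrow>
        ereal (F x p X)
          - ereal (LINT z : {z. norm z < \<epsilon>'} | levy_measure c.
              1/2 * (((X + (2 * \<delta>) *\<^sub>R mat 1) *v z) \<bullet> z))
          - ext_integral (levy_measure c) {z. norm z \<ge> \<epsilon>'}
              (\<lambda>z. u (x + z) - u x - z \<bullet> p) \<le> 0)"

end

theory Submission
  imports Defs
begin

text \<open>At a maximum point \<open>x\<^sub>0\<close> the pair \<open>(0, O)\<close> lies in the superjet and (A) holds for all positive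
  \<open>\<epsilon>\<close> and \<open>\<delta>\<close>, so letting \<open>\<delta>\<close> tend to \<open>0\<close> in the definition of a subsolution gives
  \<open>\<integral> [u(x\<^sub>0) - u(x\<^sub>0 + z)] c(z)dz \<le> 0\<close> over every region \<open>|z| \<ge> \<epsilon>\<close>. The integrand is nonnegative,
  and by upper semicontinuity it is positive on an open set, which must be empty because \<open>c(z)dz\<close>
  charges every nonempty open set. So \<open>u\<close> is in fact constant everywhere.\<close>

lemma open_upper_semicontinuous_less:
  assumes "upper_semicontinuous u"
  shows "open {x. u x < a}"
proof (subst open_subopen, intro ballI)
  fix x assume "x \<in> {x. u x < a}"
  \<comment> \<open>The tolerance \<open>a - u x\<close> is positive and turns the bound
    \<open>u x + e\<close> of upper semicontinuity into \<open>a\<close>.\<close>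
  then have "\<forall>\<^sub>F y in nhds x. u y < u x + (a - u x)"
    using assms unfolding upper_semicontinuous_def by (metis diff_gt_0_iff_gt mem_Collect_eq)
  then show "\<exists>T. open T \<and> x \<in> T \<and> T \<subseteq> {x. u x < a}"
    unfolding eventually_nhds by auto
qed

lemma borel_measurable_upper_semicontinuous:
  assumes "upper_semicontinuous u"
  shows "u \<in> borel_measurable borel"
  by (rule borel_measurableI_less) (simp add: open_upper_semicontinuous_less[OF assms])

lemma borel_measurable_levy_measure:
  assumes "f \<in> borel_measurable borel"
  shows "f \<in> borel_measurable (levy_measure c)"
proof -
  have "f \<in> borel_measurable (lebesgue_on (- {0}))"
    by (intro measurable_restrict_space1 measurable_completion) (use assms in simp)
  then show ?thesis
    unfolding levy_measure_def by simp
qed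

lemma zero_in_superjet_at_max:
  assumes "\<forall>x. u x \<le> u x0"
  shows "(0, 0) \<in> superjet u x0"
proof -
  have "(\<lambda>_. 0) \<in> o[at 0](\<lambda>z::real^'n. (norm z)\<^sup>2)"
    by simp
  moreover have "(0::real^'n^'n) \<in> symmetric_matrices"
    by (simp add: symmetric_matrices_def transpose_def vec_eq_iff)
  ultimately show ?thesis
    unfolding superjet_def using assms
    by (auto intro!: bexI[where x = "\<lambda>_. 0"])
qed

lemma superjet_bound_zero_at_max:
  assumes "\<forall>x. u x \<le> u x0" "0 < \<delta>"
  shows "superjet_bound u x0 0 0 \<epsilon> \<delta>"
  unfolding superjet_bound_def using assms by (auto intro: add_increasing2)

text \<open>Carries out the passage \<delta> \<rightarrow> 0. A priori \<open>A\<close> may be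
  infinite and \<open>I\<close> may have any sign.\<close>

lemma ennreal_eq_0_if_le_all_multiples:
  fixes A :: ennreal and I :: real
  assumes "\<And>\<delta>. 0 < \<delta> \<Longrightarrow> enn2ereal A \<le> ereal (\<delta> * I)"
  shows "A = 0"
proof -
  have "enn2ereal A \<le> 0 + ereal e" if "0 < e" for e
  proof -
    \<comment> \<open>Here \<delta> is \<open>e / (\<bar>I\<bar> + 1)\<close>: adding 1 keeps the
      denominator positive when \<open>I = 0\<close>, and \<open>\<delta> * I\<close> stays at most
      \<open>e\<close> for either sign of \<open>I\<close>.\<close>
    have "e / (\<bar>I\<bar> + 1) * I \<le> e / (\<bar>I\<bar> + 1) * (\<bar>I\<bar> + 1)"
      using that by (intro mult_left_mono) auto
    also have "\<dots> = e"
      by simp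
    finally show ?thesis
      using assms[of "e / (\<bar>I\<bar> + 1)"] that by (auto intro: order_trans)
  qed
  then have "enn2ereal A \<le> 0"
    using ereal_le_epsilon2 by blast
  then show ?thesis
    unfolding less_eq_ennreal.rep_eq[symmetric] zero_ennreal.rep_eq[symmetric] by simp
qed

lemma nonlocal_defect_at_max_eq_0:
  assumes sub: "viscosity_subsolution F c u"
    and max: "\<forall>x. u x \<le> u x0"
    and F0: "F x0 0 0 \<ge> 0"
    and "0 < \<epsilon>"
  shows "(\<integral>\<^sup>+z\<in>{z. norm z \<ge> \<epsilon>}. ennreal (u x0 - u (x0 + z)) \<partial>levy_measure c) = 0"
    (is "?A = 0")
proof (rule ennreal_eq_0_if_le_all_multiples)
  fix \<delta> :: real assume "0 < \<delta>"
  let ?M = "levy_measure c" and ?S = "{z::real^'n. norm z \<ge> \<epsilon>}"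
  let ?f = "\<lambda>z. u (x0 + z) - u x0 - z \<bullet> 0"
  \<comment> \<open>The local term of the subsolution inequality is \<delta> times this real number,
    which is the same for every \<delta>.\<close>
  define I where "I = (LINT z : {z. norm z < \<epsilon>} | ?M. (norm z)\<^sup>2)"
  have "u \<in> borel_measurable borel"
    using sub borel_measurable_upper_semicontinuous unfolding viscosity_subsolution_def by blast
  then have "(\<lambda>z. indicator ?S z *\<^sub>R ?f z) \<in> borel_measurable borel"
    by measurable
  then have "set_borel_measurable ?M ?S ?f"
    unfolding set_borel_measurable_def by (rule borel_measurable_levy_measure)
  \<comment> \<open>With \<open>p = 0\<close> the integrand is \<open>u (x0 + z) - u x0\<close>,
    which is nonpositive by maximality. Its vanishing positive part gives the integral a value in
    [-\<infinity>, 0], although \<open>u\<close> need not be bounded below.\<close>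
  moreover have pos_part: "(\<integral>\<^sup>+z\<in>?S. ennreal (?f z) \<partial>?M) = 0"
    using max by (simp add: ennreal_neg)
  ultimately have ex: "ext_integral_exists ?M ?S ?f"
    unfolding ext_integral_exists_def by simp
  have ext: "ext_integral ?M ?S ?f = - enn2ereal ?A"
    unfolding ext_integral_def pos_part by (simp add: zero_ennreal.rep_eq)
  have quad: "1/2 * (((0 + (2 * \<delta>) *\<^sub>R mat 1) *v z) \<bullet> z) = \<delta> * (norm z)\<^sup>2" for z :: "real^'n"
    by (simp add: scaleR_matrix_vector_assoc[symmetric] power2_norm_eq_inner)
  have small: "(LINT z : {z. norm z < \<epsilon>} | ?M.
      1/2 * (((0 + (2 * \<delta>) *\<^sub>R mat 1) *v z) \<bullet> z)) = \<delta> * I"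
    unfolding I_def quad by simp
  have "ereal (F x0 0 0) - ereal (\<delta> * I) - (- enn2ereal ?A) \<le> 0"
    unfolding small[symmetric] ext[symmetric]
    \<comment> \<open>Both radii of the definition are taken equal, \<epsilon>' = \<epsilon>;
      \<open>order_refl\<close> discharges \<epsilon>' \<le> \<epsilon>.\<close>
    by (rule sub[unfolded viscosity_subsolution_def, THEN conjunct2, rule_format, where \<epsilon> = \<epsilon>])
      (intro conjI zero_in_superjet_at_max superjet_bound_zero_at_max max ex
        \<open>0 < \<epsilon>\<close> \<open>0 < \<delta>\<close> order_refl)
  then show "enn2ereal ?A \<le> ereal (\<delta> * (LINT z : {z. norm z < \<epsilon>} | ?M. (norm z)\<^sup>2))"
    unfolding I_def[symmetric] using F0 by (cases "enn2ereal ?A") auto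
qed

theorem theorem5p1:
  fixes \<gamma> C1 C2 C3 :: real
    and c :: "real ^ 'n \<Rightarrow> real"
    and F :: "real ^ 'n \<Rightarrow> real ^ 'n \<Rightarrow> real ^ 'n ^ 'n \<Rightarrow> real"
    and u :: "real ^ 'n \<Rightarrow> real"
    and x0 :: "real ^ 'n"
  assumes "0 < \<gamma>" "\<gamma> < 2"
    and "0 < C1" "0 < C2" "0 < C3"
    and "positive_radon_density c"
    and "(\<integral>\<^sup>+z. ennreal (min ((norm z)\<^sup>2) 1) \<partial>levy_measure c) \<le> ennreal C1"
    and "\<forall>z. 0 < norm z \<and> norm z \<le> 1 \<longrightarrow>
           C2 / norm z powr (real CARD('n) + \<gamma>) \<le> \<bar>c z\<bar> \<and>
           \<bar>c z\<bar> \<le> C3 / norm z powr (real CARD('n) + \<gamma>)"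
    and "\<forall>D. open D \<and> D \<noteq> {} \<longrightarrow> (\<integral>\<^sup>+z\<in>D. 1 \<partial>levy_measure c) > 0"
    and "continuous_on (UNIV \<times> UNIV \<times> symmetric_matrices) (\<lambda>(x, p, X). F x p X)"
    and "degenerate_elliptic F"
    and "\<forall>x. F x 0 0 \<ge> 0"
    and "viscosity_subsolution F c u"
    and "\<forall>x. u x \<le> u x0"
  shows "\<exists>k. AE x in lebesgue. u x = k"
proof -
  have "u x = u x0" for x
  proof (rule ccontr)
    assume "u x \<noteq> u x0"
    with assms(14) have "u x < u x0"
      by (simp add: order.strict_iff_order)
    let ?M = "levy_measure c"
    \<comment> \<open>Half the distance puts \<open>x - x0\<close> strictly outside the closed ball
      of radius \<epsilon>. Hence \<open>D\<close> below can be cut out by a strict inequality,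
      which makes it open, and still lies in the region
      \<open>norm z \<ge> \<epsilon>\<close>.\<close>
    define \<epsilon> where "\<epsilon> = norm (x - x0) / 2"
    have "0 < \<epsilon>"
      using \<open>u x < u x0\<close> unfolding \<epsilon>_def by auto
    have usc: "upper_semicontinuous u"
      using assms(13) unfolding viscosity_subsolution_def by blast
    define D where "D = (\<lambda>z. x0 + z) -` {y. u y < u x0} \<inter> {z. \<epsilon> < norm z}"
    have "open ((\<lambda>z. x0 + z) -` {y. u y < u x0})"
      by (intro open_vimage open_upper_semicontinuous_less usc continuous_intros)
    moreover have "open {z::real^'n. \<epsilon> < norm z}"
      by (intro open_Collect_less continuous_intros)
    ultimately have "open D"
      unfolding D_def by (rule open_Int)
    moreover have "x - x0 \<in> D"
      using \<open>u x < u x0\<close> \<open>0 < \<epsilon>\<close> unfolding D_def \<epsilon>_def by auto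
    ultimately have pos: "(\<integral>\<^sup>+z\<in>D. 1 \<partial>?M) > 0"
      using assms(9) by blast
    have "u \<in> borel_measurable borel"
      by (rule borel_measurable_upper_semicontinuous[OF usc])
    then have "(\<lambda>z. ennreal (u x0 - u (x0 + z)) * indicator {z. norm z \<ge> \<epsilon>} z)
        \<in> borel_measurable borel"
      by measurable
    then have "AE z in ?M. ennreal (u x0 - u (x0 + z)) * indicator {z. norm z \<ge> \<epsilon>} z = 0"
      using nonlocal_defect_at_max_eq_0[OF assms(13,14) _ \<open>0 < \<epsilon>\<close>] assms(12)
      by (subst nn_integral_0_iff_AE[symmetric]) (auto intro: borel_measurable_levy_measure)
    \<comment> \<open>On \<open>D\<close> the integrand is strictly positive, so wherever it
      vanishes the indicator of \<open>D\<close> vanishes too; thus \<open>D\<close> is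
      null.\<close>
    then have "AE z in ?M. 1 * indicator D z = (0::ennreal)"
      by eventually_elim (auto simp: D_def indicator_def ennreal_eq_0_iff split: if_splits)
    then have "(\<integral>\<^sup>+z\<in>D. 1 \<partial>?M) = (\<integral>\<^sup>+z. 0 \<partial>?M)"
      by (rule nn_integral_cong_AE)
    with pos show False
      by simp
  qed
  then show ?thesis
    by auto
qed

end
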